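(* Let $n\ge 1$ and let $f\in C_0(\mathbb{R}^n)$ be complex-valued. Let $N\ge 2$, let $\Lambda=\{(x_i,\omega_i)\}_{i=1}^N\subset\mathbb{R}^{2n}$ (with $x_i,\omega_i\in\mathbb{R}^n$) be a finite set, and let $R>0$ be such that $|f(t)|<\frac{|f(0)|}{N-1}$ for all $t\in\mathbb{R}^n$ with $\|t\|>R$. If $\|x_i-x_j\|>R$ whenever $i\ne j$, then the family $\mathcal{G}(f,\Lambda)=\{\pi(x_i,\omega_i)f\}_{i=1}^N$ is linearly independent over $\mathbb{C}$.
   Context: $C_0(\mathbb{R}^n)$ is the space of continuous functions $f:\mathbb{R}^n\to\mathbb{C}$ with $|f(t)|\to 0$ as $\|t\|\to\infty$; $\|\cdot\|$ is the Euclidean norm. For $(x,\omega)\in\mathbb{R}^n\times\mathbb{R}^n$, the time-frequency shift is $(\pi(x,\omega)f)(t)=e^{2\pi i\,\omega\cdot t}f(t-x)$. *)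

theory Defs
  imports "HOL-Analysis.Analysis" "HOL-Library.Function_Algebras"
begin

definition C0 :: "(real ^ 'n \<Rightarrow> complex) set" where
  "C0 = {f. continuous_on UNIV f \<and> ((\<lambda>t. norm (f t)) \<longlongrightarrow> 0) at_infinity}"

definition tf_shift ::
    "(real ^ 'n) \<times> (real ^ 'n) \<Rightarrow> (real ^ 'n \<Rightarrow> complex) \<Rightarrow> real ^ 'n \<Rightarrow> complex" where
  "tf_shift = (\<lambda>(x, \<omega>) f t. exp (2 * of_real pi * \<i> * of_real (\<omega> \<bullet> t)) * f (t - x))"

text \<open>
  Linear independence over the complex numbers of a finite family of functions. The members are
  indexed, so a family in which some function occurs twice is dependent; the lemma below relates
  this to the library's notion of independence, which is about sets of vectors.
\<close>

definition lin_indep_family :: "'i set \<Rightarrow> ('i \<Rightarrow> 'a \<Rightarrow> complex) \<Rightarrow> bool" where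
  "lin_indep_family I g \<longleftrightarrow>
     (\<forall>c :: 'i \<Rightarrow> complex. (\<forall>t. (\<Sum>i\<in>I. c i * g i t) = 0) \<longrightarrow> (\<forall>i\<in>I. c i = 0))"

lemma vector_space_complex_fun:
  "vector_space (\<lambda>(c::complex) (f :: 'a \<Rightarrow> complex) t. c * f t)"
  by unfold_locales (auto simp: fun_eq_iff algebra_simps)

lemma sum_fun_apply: "(\<Sum>i\<in>A. h i) t = (\<Sum>i\<in>A. h i t :: complex)"
  by (induction A rule: infinite_finite_induct) auto

lemma lin_indep_family_iff_independent:
  fixes g :: "'i \<Rightarrow> 'a \<Rightarrow> complex"
  assumes "finite I"
  shows "lin_indep_family I g \<longleftrightarrow>
    inj_on g I \<and> \<not> module.dependent (\<lambda>(c::complex) (f :: 'a \<Rightarrow> complex) t. c * f t) (g ` I)"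
proof -
  interpret V: vector_space "\<lambda>(c::complex) (f :: 'a \<Rightarrow> complex) t. c * f t"
    by (rule vector_space_complex_fun)
  have inj: "inj_on g I" if L: "lin_indep_family I g"
  proof (rule inj_onI, rule ccontr)
    fix i j assume ij: "i \<in> I" "j \<in> I" "g i = g j" "i \<noteq> j"
    define c :: "'i \<Rightarrow> complex" where
      "c k = (if k = i then 1 else 0) - (if k = j then 1 else 0)" for k
    have "(\<Sum>k\<in>I. c k * g k t) = 0" for t
    proof -
      have "(\<Sum>k\<in>I. c k * g k t) =
          (\<Sum>k\<in>I. (if k = i then g k t else 0) - (if k = j then g k t else 0))"
        by (rule sum.cong) (auto simp: c_def)
      also have "\<dots> = 0"
        using ij assms by (simp add: sum_subtractf sum.delta)
      finally show ?thesis .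
    qed
    with L ij(1) have "c i = 0" by (auto simp: lin_indep_family_def)
    with ij(4) show False by (simp add: c_def)
  qed
  have eq: "lin_indep_family I g \<longleftrightarrow> \<not> V.dependent (g ` I)" if g: "inj_on g I"
  proof -
    have reindex: "(\<Sum>v\<in>g ` I. (\<lambda>t. u v * v t)) = 0 \<longleftrightarrow> (\<forall>t. (\<Sum>i\<in>I. u (g i) * g i t) = 0)"
      for u :: "('a \<Rightarrow> complex) \<Rightarrow> complex"
      by (simp add: sum.reindex[OF g] fun_eq_iff sum_fun_apply)
    have "\<not> V.dependent (g ` I) \<longleftrightarrow>
        (\<forall>u. (\<forall>t. (\<Sum>i\<in>I. u (g i) * g i t) = 0) \<longrightarrow> (\<forall>i\<in>I. u (g i) = 0))"
      using assms by (auto simp: V.dependent_finite reindex)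
    also have "\<dots> \<longleftrightarrow> lin_indep_family I g"
    proof
      assume U: "\<forall>u. (\<forall>t. (\<Sum>i\<in>I. u (g i) * g i t) = 0) \<longrightarrow> (\<forall>i\<in>I. u (g i) = 0)"
      show "lin_indep_family I g"
        unfolding lin_indep_family_def
      proof (intro allI impI)
        fix c assume c: "\<forall>t. (\<Sum>i\<in>I. c i * g i t) = 0"
        have "(\<Sum>i\<in>I. c (the_inv_into I g (g i)) * g i t) = (\<Sum>i\<in>I. c i * g i t)" for t
          by (rule sum.cong) (auto simp: the_inv_into_f_f[OF g])
        with c U[rule_format, of "\<lambda>v. c (the_inv_into I g v)"]
        show "\<forall>i\<in>I. c i = 0" by (simp add: the_inv_into_f_f[OF g])
      qed
    next
      assume L: "lin_indep_family I g"
      show "\<forall>u. (\<forall>t. (\<Sum>i\<in>I. u (g i) * g i t) = 0) \<longrightarrow> (\<forall>i\<in>I. u (g i) = 0)"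
      proof
        fix u
        show "(\<forall>t. (\<Sum>i\<in>I. u (g i) * g i t) = 0) \<longrightarrow> (\<forall>i\<in>I. u (g i) = 0)"
          using L[unfolded lin_indep_family_def, rule_format, of "\<lambda>i. u (g i)"] by blast
      qed
    qed
    finally show ?thesis by simp
  qed
  show ?thesis using inj eq by blast
qed

end

theory Submission
  imports Defs
begin

text \<open>
  Evaluating the family at the points \<open>x\<^sub>k\<close> gives a matrix that is strictly diagonally dominant,
  so already these evaluations force all coefficients to vanish.
\<close>

lemma lin_indep_family_if_diagonally_dominant:
  assumes "finite I"
    and dominant: "\<And>k. k \<in> I \<Longrightarrow> (\<Sum>i\<in>I - {k}. norm (g i (p k))) < norm (g k (p k))"
  shows "lin_indep_family I g"
  unfolding lin_indep_family_def
proof (intro allI impI ballI)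
  fix c j
  assume zero: "\<forall>t. (\<Sum>i\<in>I. c i * g i t) = 0" and j: "j \<in> I"
  \<comment> \<open>The usual argument for diagonally dominant matrices: pick a coefficient
    \<open>c k\<close> of largest modulus \<open>m\<close> and look only at the relation at the
    point \<open>p k\<close>.\<close>
  define m where "m = Max ((\<lambda>i. norm (c i)) ` I)"
  have le: "norm (c i) \<le> m" if "i \<in> I" for i
    using that \<open>finite I\<close> by (simp add: m_def)
  have "m \<in> (\<lambda>i. norm (c i)) ` I"
    unfolding m_def using j \<open>finite I\<close> by (intro Max_in) auto
  then obtain k where k: "k \<in> I" "norm (c k) = m" by auto
  have "c k * g k (p k) = - (\<Sum>i\<in>I - {k}. c i * g i (p k))"
    using zero[rule_format, of "p k"] sum.remove[OF \<open>finite I\<close> k(1), of "\<lambda>i. c i * g i (p k)"]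
    by (simp add: eq_neg_iff_add_eq_0)
  then have "m * norm (g k (p k)) = norm (\<Sum>i\<in>I - {k}. c i * g i (p k))"
    by (metis k(2) norm_minus_cancel norm_mult)
  also have "\<dots> \<le> (\<Sum>i\<in>I - {k}. m * norm (g i (p k)))"
    by (intro sum_norm_le) (auto simp: norm_mult intro!: mult_right_mono le)
  also have "\<dots> = m * (\<Sum>i\<in>I - {k}. norm (g i (p k)))"
    by (simp add: sum_distrib_left)
  \<comment> \<open>If \<open>m\<close> were positive, cancelling it from the chain would contradict
    dominance in row \<open>k\<close>.\<close>
  finally have "m \<le> 0"
    using dominant[OF k(1)] by (meson mult_less_cancel_left_pos not_le)
  with le[OF j] show "c j = 0" using order_trans norm_le_zero_iff by blast
qed

text \<open>The modulation factor has modulus 1 because its exponent is purely imaginary. Hence the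
  frequencies do not affect dominance.\<close>

lemma norm_tf_shift: "norm (tf_shift (x, \<omega>) f t) = norm (f (t - x))"
  by (simp add: tf_shift_def norm_mult)

theorem theorem1:
  fixes f :: "real ^ 'n \<Rightarrow> complex"
    and N :: nat
    and x \<omega> :: "nat \<Rightarrow> real ^ 'n"
    and R :: real
  assumes "f \<in> C0"
    and "N \<ge> 2"
    and "R > 0"
    and "\<And>t. norm t > R \<Longrightarrow> norm (f t) < norm (f 0) / (real N - 1)"
    and "\<And>i j. i \<in> {1..N} \<Longrightarrow> j \<in> {1..N} \<Longrightarrow> i \<noteq> j \<Longrightarrow> norm (x i - x j) > R"
  shows "lin_indep_family {1..N} (\<lambda>i. tf_shift (x i, \<omega> i) f)"
\<comment> \<open>At \<open>x k\<close> the diagonal entry has modulus \<open>norm (f 0)\<close>,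
  while every other entry samples \<open>f\<close> at \<open>x k - x i\<close>, farther than
  \<open>R\<close> from the origin.\<close>
proof (rule lin_indep_family_if_diagonally_dominant[where p = x])
  fix k assume k: "k \<in> {1..N}"
  have card: "card ({1..N} - {k}) = N - 1"
    using k by simp
  \<comment> \<open>A termwise strict bound gives a strict bound on the sums only over a nonempty
    index set.\<close>
  then have "{1..N} - {k} \<noteq> {}"
    using \<open>N \<ge> 2\<close> by (metis One_nat_def card.empty diff_is_0_eq not_less_eq_eq numeral_2_eq_2)
  then have "(\<Sum>i\<in>{1..N} - {k}. norm (f (x k - x i))) <
      (\<Sum>i\<in>{1..N} - {k}. norm (f 0) / (real N - 1))"
    using k by (intro sum_strict_mono assms(4,5)) auto
  also have "\<dots> = norm (f 0)"
    using \<open>N \<ge> 2\<close> card by (simp add: of_nat_diff)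
  finally show "(\<Sum>i\<in>{1..N} - {k}. norm (tf_shift (x i, \<omega> i) f (x k)))
      < norm (tf_shift (x k, \<omega> k) f (x k))"
    by (simp add: norm_tf_shift)
qed simp

end
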